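(* Let $f:I\to\mathbb{R}$ be continuous at $0$. Then the function $$F(t)=-\sum_{k=0}^{\infty}q^{[k]_n}t^{n^k}\left(q^{n^k}t^{n^k(n-1)}-1\right)f\left(q^{[k]_n}t^{n^k}\right)$$ is an $n,q$-antiderivative of $f$ on $I$, i.e. $D_{n,q}F(t)=f(t)$ for all $t\in I$.
   Context: Fix $0<q<1$ and an odd positive integer $n$. Put $\theta=\infty$ if $n=1$ and $\theta=q^{1/(1-n)}$ if $n\ge 3$; $S=\{0\}$ if $n=1$ and $S=\{-\theta,0,\theta\}$ if $n\ge 3$; $I=(-\theta,\theta)$; $[0]_n=0$ and $[k]_n=\sum_{i=0}^{k-1}n^i$ for $k\ge 1$. The power difference operator is $D_{n,q}F(t)=\dfrac{F(qt^n)-F(t)}{qt^n-t}$ if $t\notin S$, and $D_{n,q}F(t)=F'(t)$ if $t\in S$ (provided the derivative exists). All series that occur are assumed convergent. *)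

theory Defs
  imports "HOL-Analysis.Analysis"
begin

definition nq_theta :: "nat \<Rightarrow> real \<Rightarrow> ereal" where
  "nq_theta n q = (if n = 1 then \<infinity> else ereal (q powr (1 / (1 - real n))))"

definition nq_S :: "nat \<Rightarrow> real \<Rightarrow> real set" where
  "nq_S n q =
     (if n = 1 then {0} else {t. ereal t \<in> {- nq_theta n q, 0, nq_theta n q}})"

definition nq_I :: "nat \<Rightarrow> real \<Rightarrow> real set" where
  "nq_I n q = {t. - nq_theta n q < ereal t \<and> ereal t < nq_theta n q}"

definition nq_bracket :: "nat \<Rightarrow> nat \<Rightarrow> nat" where
  "nq_bracket n k = (\<Sum>i<k. n ^ i)"

definition nq_deriv :: "nat \<Rightarrow> real \<Rightarrow> (real \<Rightarrow> real) \<Rightarrow> real \<Rightarrow> real" where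
  "nq_deriv n q F t =
     (if t \<in> nq_S n q then deriv F t
      else (F (q * t ^ n) - F t) / (q * t ^ n - t))"

text \<open>
  As \<^const>\<open>deriv\<close> is total, the proviso that the ordinary derivative exists
  at the exceptional points has to be imposed separately.
\<close>

definition nq_differentiable :: "nat \<Rightarrow> real \<Rightarrow> (real \<Rightarrow> real) \<Rightarrow> real \<Rightarrow> bool" where
  "nq_differentiable n q F t \<longleftrightarrow> (t \<in> nq_S n q \<longrightarrow> F field_differentiable (at t))"

definition nq_antiderivative_on ::
  "nat \<Rightarrow> real \<Rightarrow> (real \<Rightarrow> real) \<Rightarrow> (real \<Rightarrow> real) \<Rightarrow> real set \<Rightarrow> bool" where
  "nq_antiderivative_on n q F f A \<longleftrightarrow>
     (\<forall>t\<in>A. nq_differentiable n q F t \<and> nq_deriv n q F t = f t)"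

end

theory Submission
  imports Defs
begin

text \<open>
  Write \<open>\<phi>(t) = q * t ^ n\<close> and let \<open>x\<^sub>k\<close> be the \<open>k\<close>-th iterate of \<open>\<phi>\<close> at \<open>t\<close>. The exponents in the
  series are exactly those of the iterates: \<open>x\<^sub>k = q ^ [k] * t ^ (n ^ k)\<close>, and the factor
  in front of \<open>f(x\<^sub>k)\<close> is \<open>x\<^bsub>k+1\<^esub> - x\<^sub>k\<close>. Hence \<open>F(t) = \<Sum>\<^sub>k (x\<^sub>k - x\<^bsub>k+1\<^esub>) * f(x\<^sub>k)\<close> is a Riemann sum for
  the integral of \<open>f\<close> from \<open>0\<close> to \<open>t\<close> along the orbit of \<open>t\<close>.

  Replacing \<open>t\<close> by \<open>\<phi>(t)\<close> drops the first summand, so \<open>F(\<phi>(t)) - F(t) = (\<phi>(t) - t) * f(t)\<close>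
  (\<open>nq_jackson_map\<close>). This settles every point of the interval other than \<open>0\<close>, because the fixed points of
  \<open>\<phi>\<close> are \<open>0\<close> and, for \<open>n \<ge> 3\<close>, the end points of the interval.

  At \<open>0\<close> an ordinary derivative is required. Inside the interval \<open>\<phi>\<close> contracts towards \<open>0\<close>, and it preserves signs as
  \<open>n\<close> is odd. The orbit therefore decreases monotonically in absolute value to \<open>0\<close>, the increments sum
  to \<open>t\<close> and their absolute values sum to \<open>\<bar>t\<bar>\<close>. So \<open>F(t) - t * f(0)\<close> is at most \<open>\<bar>t\<bar>\<close> times the
  largest deviation of \<open>f\<close> from \<open>f(0)\<close> on the orbit (\<open>telescoping_weighted_mean\<close>), which is small by
  continuity.
\<close>

section \<open>The interval and the power map\<close>

definition nq_map :: "nat \<Rightarrow> real \<Rightarrow> real \<Rightarrow> real" where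
  "nq_map n q t = q * t ^ n"

lemma funpow_nq_map: "(nq_map n q ^^ k) t = q ^ nq_bracket n k * t ^ (n ^ k)"
proof (induction k)
  case 0
  then show ?case by (simp add: nq_bracket_def)
next
  case (Suc k)
  have "nq_bracket n (Suc k) = Suc (n * nq_bracket n k)"
    unfolding nq_bracket_def
    by (simp add: sum.lessThan_Suc_shift sum_distrib_left del: sum.lessThan_Suc)
  moreover have "(nq_map n q ^^ Suc k) t = q * (q ^ nq_bracket n k * t ^ (n ^ k)) ^ n"
    by (simp add: Suc) (simp add: nq_map_def)
  ultimately show ?case
    by (simp add: power_mult_distrib mult.commute[of n] flip: power_mult)
qed

lemma mem_nq_I_iff: "t \<in> nq_I n q \<longleftrightarrow> ereal \<bar>t\<bar> < nq_theta n q"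
  by (cases "nq_theta n q") (auto simp: nq_I_def)

lemma nq_theta_pos: "0 < q \<Longrightarrow> 0 < nq_theta n q"
  by (simp add: nq_theta_def)

lemma zero_mem_nq_I: "0 < q \<Longrightarrow> 0 \<in> nq_I n q"
  using nq_theta_pos by (simp add: mem_nq_I_iff zero_ereal_def[symmetric])

lemma open_nq_I: "open (nq_I n q)"
  unfolding nq_I_def
  by (intro open_Collect_conj open_Collect_less continuous_intros)

lemma nq_I_abs_le: "t \<in> nq_I n q \<Longrightarrow> \<bar>s\<bar> \<le> \<bar>t\<bar> \<Longrightarrow> s \<in> nq_I n q"
  unfolding mem_nq_I_iff by (meson ereal_less_eq(3) le_less_trans)

lemma nq_S_Int_nq_I: "t \<in> nq_S n q \<Longrightarrow> t \<in> nq_I n q \<Longrightarrow> t = 0"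
  by (auto simp: nq_S_def nq_I_def zero_ereal_def split: if_splits)

lemma zero_mem_nq_S: "0 \<in> nq_S n q"
  by (simp add: nq_S_def zero_ereal_def)

text \<open>
  The radius \<open>\<theta>\<close> is the solution of \<open>q * \<theta> ^ (n - 1) = 1\<close>, and \<open>\<phi>(t) = q * t ^ (n - 1) * t\<close>. This makes
  \<open>q * \<bar>t\<bar> ^ (n - 1)\<close> the contraction rate of \<open>\<phi>\<close> at \<open>t\<close>.
\<close>

lemma nq_rate_less_1:
  assumes "0 < q" "q < 1" "n > 0" "t \<in> nq_I n q"
  shows "q * \<bar>t\<bar> ^ (n - 1) < 1"
proof (cases "n = 1")
  case True
  with assms show ?thesis by simp
next
  case False
  define \<theta> where "\<theta> = q powr (1 / (1 - real n))"
  have "\<theta> > 0" using assms by (simp add: \<theta>_def)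
  have "\<bar>t\<bar> < \<theta>"
    using assms False by (simp add: mem_nq_I_iff nq_theta_def \<theta>_def)
  then have "\<bar>t\<bar> ^ (n - 1) < \<theta> ^ (n - 1)"
    using False assms by (intro power_strict_mono) auto
  also have "\<theta> ^ (n - 1) = \<theta> powr real (n - 1)"
    using \<open>\<theta> > 0\<close> by (simp add: powr_realpow)
  also have "\<dots> = q powr (1 / (1 - real n) * real (n - 1))"
    by (simp add: \<theta>_def powr_powr)
  also have "1 / (1 - real n) * real (n - 1) = - 1"
    using False assms by (simp add: of_nat_diff field_simps)
  also have "q powr - 1 = 1 / q"
    using assms by (simp add: powr_minus_divide)
  finally show ?thesis using assms by (simp add: field_simps)
qed

lemma nq_map_eq_rate:
  assumes "odd n"
  shows "nq_map n q t = q * \<bar>t\<bar> ^ (n - 1) * t"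
proof -
  have "t ^ n = t ^ (n - 1) * t"
    using assms by (metis odd_pos power_minus_mult)
  moreover have "\<bar>t\<bar> ^ (n - 1) = t ^ (n - 1)"
    using assms by (simp add: power_even_abs)
  ultimately show ?thesis by (simp add: nq_map_def)
qed

lemma nq_map_mem:
  assumes "0 < q" "q < 1" "odd n" "t \<in> nq_I n q"
  shows "nq_map n q t \<in> nq_I n q" and "\<bar>nq_map n q t\<bar> \<le> \<bar>t\<bar>"
proof -
  have "q * \<bar>t\<bar> ^ (n - 1) < 1"
    using assms nq_rate_less_1 odd_pos by blast
  then show "\<bar>nq_map n q t\<bar> \<le> \<bar>t\<bar>"
    using assms by (simp add: nq_map_eq_rate abs_mult mult_left_le_one_le)
  then show "nq_map n q t \<in> nq_I n q"
    using assms nq_I_abs_le by blast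
qed

lemma nq_map_fixpoint:
  assumes "0 < q" "q < 1" "odd n" "t \<in> nq_I n q" "nq_map n q t = t"
  shows "t = 0"
  using assms nq_rate_less_1[of q n t] by (auto simp: nq_map_eq_rate odd_pos)

text \<open>
  As \<open>n\<close> is odd, a step of the orbit never crosses \<open>0\<close>, so its length is the loss in absolute
  value.
\<close>

lemma abs_diff_nq_map:
  assumes "0 < q" "q < 1" "odd n" "t \<in> nq_I n q"
  shows "\<bar>t - nq_map n q t\<bar> = \<bar>t\<bar> - \<bar>nq_map n q t\<bar>"
proof -
  define c where "c = q * \<bar>t\<bar> ^ (n - 1)"
  have c: "0 \<le> c" "c < 1"
    using assms nq_rate_less_1[of q n t] by (auto simp: c_def odd_pos)
  have "nq_map n q t = c * t"
    using assms by (simp add: nq_map_eq_rate c_def)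
  moreover have "t - c * t = (1 - c) * t"
    by (simp add: algebra_simps)
  ultimately have "\<bar>t - nq_map n q t\<bar> = (1 - c) * \<bar>t\<bar>" "\<bar>nq_map n q t\<bar> = c * \<bar>t\<bar>"
    using c by (simp_all add: abs_mult)
  then show ?thesis
    by (simp add: algebra_simps)
qed

lemma funpow_nq_map_mem:
  assumes "0 < q" "q < 1" "odd n" "t \<in> nq_I n q"
  shows "(nq_map n q ^^ k) t \<in> nq_I n q \<and> \<bar>(nq_map n q ^^ k) t\<bar> \<le> \<bar>t\<bar>"
proof (induction k)
  case 0
  then show ?case using assms by simp
next
  case (Suc k)
  then show ?case
    using nq_map_mem[OF assms(1-3), of "(nq_map n q ^^ k) t"] by auto
qed

text \<open>
  The rate at a later point of the orbit is at most the rate at \<open>t\<close>, so the orbit is dominated by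
  a geometric sequence.
\<close>

lemma funpow_nq_map_tendsto_0:
  assumes "0 < q" "q < 1" "odd n" "t \<in> nq_I n q"
  shows "(\<lambda>k. (nq_map n q ^^ k) t) \<longlonglongrightarrow> 0"
proof -
  define c where "c = q * \<bar>t\<bar> ^ (n - 1)"
  have c: "0 \<le> c" "c < 1"
    using assms nq_rate_less_1[of q n t] by (auto simp: c_def odd_pos)
  have bound: "\<bar>(nq_map n q ^^ k) t\<bar> \<le> c ^ k * \<bar>t\<bar>" for k
  proof (induction k)
    case 0
    then show ?case by simp
  next
    case (Suc k)
    let ?x = "(nq_map n q ^^ k) t"
    have "q * \<bar>?x\<bar> ^ (n - 1) \<le> c"
      unfolding c_def using funpow_nq_map_mem[OF assms, of k] assms
      by (intro mult_left_mono power_mono) auto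
    then have "q * \<bar>?x\<bar> ^ (n - 1) * \<bar>?x\<bar> \<le> c * (c ^ k * \<bar>t\<bar>)"
      using Suc c assms by (intro mult_mono) auto
    then show ?case
      using assms by (simp add: nq_map_eq_rate[of n q ?x] abs_mult mult.assoc)
  qed
  have "(\<lambda>k. c ^ k * \<bar>t\<bar>) \<longlonglongrightarrow> 0"
    using c by (intro tendsto_mult_left_zero LIMSEQ_realpow_zero)
  then show ?thesis
    by (rule Lim_null_comparison[rotated]) (simp add: bound)
qed

section \<open>Weighted means along a sequence shrinking to zero\<close>

text \<open>
  The increments \<open>x k - x (Suc k)\<close> act as weights of total mass \<open>x 0\<close> and total variation \<open>\<bar>x 0\<bar>\<close>, so
  the weighted sum of values that are within \<open>e\<close> of \<open>L\<close> is within \<open>e * \<bar>x 0\<bar>\<close> of \<open>L * x 0\<close>.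
\<close>

lemma telescoping_weighted_mean:
  fixes x g :: "nat \<Rightarrow> real"
  assumes lim: "x \<longlonglongrightarrow> 0"
    and mono: "\<And>k. \<bar>x k - x (Suc k)\<bar> = \<bar>x k\<bar> - \<bar>x (Suc k)\<bar>"
    and sm: "summable (\<lambda>k. (x (Suc k) - x k) * g k)"
    and close: "\<And>k. \<bar>g k - L\<bar> \<le> e"
  shows "\<bar>- (\<Sum>k. (x (Suc k) - x k) * g k) - L * x 0\<bar> \<le> e * \<bar>x 0\<bar>"
proof -
  have tele: "(\<lambda>k. x k - x (Suc k)) sums x 0"
    using telescope_sums'[OF lim] by simp
  have "(\<lambda>k. \<bar>x k\<bar>) \<longlonglongrightarrow> 0"
    using lim by (rule tendsto_rabs_zero)
  then have "(\<lambda>k. \<bar>x k\<bar> - \<bar>x (Suc k)\<bar>) sums \<bar>x 0\<bar>"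
    using telescope_sums' by fastforce
  then have tele_abs: "(\<lambda>k. \<bar>x k - x (Suc k)\<bar>) sums \<bar>x 0\<bar>"
    by (simp add: mono)
  have "(\<lambda>k. - ((x (Suc k) - x k) * g k) - L * (x k - x (Suc k))) sums
      (- (\<Sum>k. (x (Suc k) - x k) * g k) - L * x 0)"
    by (intro sums_diff sums_minus sums_mult tele summable_sums sm)
  then have dev: "(\<lambda>k. (x k - x (Suc k)) * (g k - L)) sums
      (- (\<Sum>k. (x (Suc k) - x k) * g k) - L * x 0)"
    by (simp add: algebra_simps)
  have maj: "(\<lambda>k. e * \<bar>x k - x (Suc k)\<bar>) sums (e * \<bar>x 0\<bar>)"
    by (intro sums_mult tele_abs)
  have "norm (\<Sum>k. (x k - x (Suc k)) * (g k - L)) \<le> (\<Sum>k. e * \<bar>x k - x (Suc k)\<bar>)"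
  proof (rule norm_suminf_le)
    show "norm ((x k - x (Suc k)) * (g k - L)) \<le> e * \<bar>x k - x (Suc k)\<bar>" for k
      using mult_right_mono[OF close, of "\<bar>x k - x (Suc k)\<bar>" k]
      by (simp add: abs_mult mult.commute)
  qed (use maj in \<open>blast intro: sums_summable\<close>)
  then show ?thesis
    using sums_unique[OF dev] sums_unique[OF maj] by simp
qed

section \<open>The sum along the orbit\<close>

definition nq_jackson_term :: "nat \<Rightarrow> real \<Rightarrow> (real \<Rightarrow> real) \<Rightarrow> real \<Rightarrow> nat \<Rightarrow> real" where
  "nq_jackson_term n q f t k =
     ((nq_map n q ^^ Suc k) t - (nq_map n q ^^ k) t) * f ((nq_map n q ^^ k) t)"

definition nq_jackson :: "nat \<Rightarrow> real \<Rightarrow> (real \<Rightarrow> real) \<Rightarrow> real \<Rightarrow> real" where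
  "nq_jackson n q f t = - (\<Sum>k. nq_jackson_term n q f t k)"

lemma nq_jackson_term_eq:
  assumes "n > 0"
  shows "nq_jackson_term n q f t k = q ^ nq_bracket n k * t ^ (n ^ k)
    * (q ^ (n ^ k) * t ^ (n ^ k * (n - 1)) - 1) * f (q ^ nq_bracket n k * t ^ (n ^ k))"
proof -
  have b: "nq_bracket n (Suc k) = nq_bracket n k + n ^ k"
    by (simp add: nq_bracket_def)
  have e: "n ^ Suc k = n ^ k + n ^ k * (n - 1)"
    using assms by (cases n) (simp_all add: algebra_simps)
  show ?thesis
    unfolding nq_jackson_term_def funpow_nq_map b e power_add
    by (simp add: algebra_simps)
qed

text \<open>The orbit of \<open>\<phi>(t)\<close> is the orbit of \<open>t\<close> without its first point.\<close>

lemma nq_jackson_map: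
  assumes "summable (nq_jackson_term n q f t)"
  shows "nq_jackson n q f (nq_map n q t) - nq_jackson n q f t = (nq_map n q t - t) * f t"
proof -
  have "nq_jackson_term n q f (nq_map n q t) k = nq_jackson_term n q f t (Suc k)" for k
    by (simp add: nq_jackson_term_def flip: funpow_swap1)
  moreover have "nq_jackson_term n q f t 0 = (nq_map n q t - t) * f t"
    by (simp add: nq_jackson_term_def)
  ultimately show ?thesis
    using suminf_split_head[OF assms] by (simp add: nq_jackson_def)
qed

lemma nq_jackson_has_derivative_at_0:
  assumes "0 < q" "q < 1" "odd n"
    and cont: "continuous (at 0 within nq_I n q) f"
    and sm: "\<And>t. t \<in> nq_I n q \<Longrightarrow> summable (nq_jackson_term n q f t)"
  shows "(nq_jackson n q f has_field_derivative f 0) (at 0)"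
proof -
  have zero: "0 \<in> nq_I n q"
    using assms by (simp add: zero_mem_nq_I)
  have "(nq_map n q ^^ k) 0 = 0" for k
    using assms by (simp add: funpow_nq_map odd_pos)
  then have F0: "nq_jackson n q f 0 = 0"
    by (simp add: nq_jackson_def nq_jackson_term_def del: funpow.simps)
  have "((\<lambda>t. nq_jackson n q f t / t) \<longlongrightarrow> f 0) (at 0 within nq_I n q)"
  proof (rule tendstoI)
    fix e :: real
    assume "e > 0"
    then have "\<exists>d>0. \<forall>s\<in>nq_I n q. dist s 0 < d \<longrightarrow> dist (f s) (f 0) < e / 2"
      using cont unfolding continuous_within_eps_delta by (meson half_gt_zero)
    then obtain d where "d > 0"
      and d: "\<And>s. s \<in> nq_I n q \<Longrightarrow> \<bar>s\<bar> < d \<Longrightarrow> \<bar>f s - f 0\<bar> < e / 2"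
      by (auto simp: dist_real_def)
    have "dist (nq_jackson n q f t / t) (f 0) < e"
      if t: "t \<in> nq_I n q" "t \<noteq> 0" "\<bar>t\<bar> < d" for t
    proof -
      let ?x = "\<lambda>k. (nq_map n q ^^ k) t"
      have "\<bar>- (\<Sum>k. (?x (Suc k) - ?x k) * f (?x k)) - f 0 * ?x 0\<bar> \<le> e / 2 * \<bar>?x 0\<bar>"
      proof (rule telescoping_weighted_mean)
        show "?x \<longlonglongrightarrow> 0"
          using assms t by (intro funpow_nq_map_tendsto_0)
        show "\<bar>?x k - ?x (Suc k)\<bar> = \<bar>?x k\<bar> - \<bar>?x (Suc k)\<bar>" for k
          using assms funpow_nq_map_mem[of q n t k] t by (simp add: abs_diff_nq_map)
        show "summable (\<lambda>k. (?x (Suc k) - ?x k) * f (?x k))"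
          using sm[OF t(1)] unfolding nq_jackson_term_def .
        show "\<bar>f (?x k) - f 0\<bar> \<le> e / 2" for k
          using d[of "?x k"] funpow_nq_map_mem[of q n t k] assms t by force
      qed
      then have "\<bar>nq_jackson n q f t - f 0 * t\<bar> \<le> e / 2 * \<bar>t\<bar>"
        by (simp add: nq_jackson_def nq_jackson_term_def)
      moreover have "nq_jackson n q f t / t - f 0 = (nq_jackson n q f t - f 0 * t) / t"
        using t by (simp add: field_simps)
      ultimately have "\<bar>nq_jackson n q f t / t - f 0\<bar> \<le> e / 2"
        using t by (simp add: abs_divide divide_le_eq)
      with \<open>e > 0\<close> show ?thesis by (simp add: dist_real_def)
    qed
    then show "\<forall>\<^sub>F t in at 0 within nq_I n q. dist (nq_jackson n q f t / t) (f 0) < e"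
      using \<open>d > 0\<close> unfolding eventually_at by (auto simp: dist_real_def)
  qed
  then have "(nq_jackson n q f has_field_derivative f 0) (at 0 within nq_I n q)"
    by (simp add: has_field_derivative_iff F0)
  then show ?thesis
    using at_within_open[OF zero open_nq_I] by simp
qed

theorem theorem12:
  fixes q :: real and n :: nat and f :: "real \<Rightarrow> real"
  assumes "0 < q" and "q < 1" and "odd n"
    and "continuous (at 0 within nq_I n q) f"
    and "\<And>t. t \<in> nq_I n q \<Longrightarrow>
      summable (\<lambda>k. q ^ nq_bracket n k * t ^ (n ^ k)
        * (q ^ (n ^ k) * t ^ (n ^ k * (n - 1)) - 1) * f (q ^ nq_bracket n k * t ^ (n ^ k)))"
  shows "nq_antiderivative_on n q
    (\<lambda>t. - (\<Sum>k. q ^ nq_bracket n k * t ^ (n ^ k)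
        * (q ^ (n ^ k) * t ^ (n ^ k * (n - 1)) - 1) * f (q ^ nq_bracket n k * t ^ (n ^ k))))
    f (nq_I n q)"
proof -
  have term_eq: "nq_jackson_term n q f t = (\<lambda>k. q ^ nq_bracket n k * t ^ (n ^ k)
      * (q ^ (n ^ k) * t ^ (n ^ k * (n - 1)) - 1) * f (q ^ nq_bracket n k * t ^ (n ^ k)))" for t
    using assms(3) by (intro ext nq_jackson_term_eq odd_pos)
  have sm: "summable (nq_jackson_term n q f t)" if "t \<in> nq_I n q" for t
    unfolding term_eq using assms(5)[OF that] .
  have deriv0: "(nq_jackson n q f has_field_derivative f 0) (at 0)"
    using assms(1-4) sm by (rule nq_jackson_has_derivative_at_0)
  have "nq_antiderivative_on n q (nq_jackson n q f) f (nq_I n q)"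
    unfolding nq_antiderivative_on_def
  proof
    fix t
    assume t: "t \<in> nq_I n q"
    show "nq_differentiable n q (nq_jackson n q f) t \<and> nq_deriv n q (nq_jackson n q f) t = f t"
    proof (cases "t = 0")
      case True
      then show ?thesis
        using deriv0 zero_mem_nq_S[of n q]
        by (auto simp: nq_differentiable_def nq_deriv_def field_differentiable_def
            intro: DERIV_imp_deriv)
    next
      case False
      then have "t \<notin> nq_S n q" "nq_map n q t \<noteq> t"
        using t nq_S_Int_nq_I nq_map_fixpoint[OF assms(1-3)] by blast+
      then show ?thesis
        using nq_jackson_map[OF sm[OF t]]
        by (simp add: nq_differentiable_def nq_deriv_def flip: nq_map_def)
    qed
  qed
  moreover have "nq_jackson n q f = (\<lambda>t. - (\<Sum>k. q ^ nq_bracket n k * t ^ (n ^ k)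
      * (q ^ (n ^ k) * t ^ (n ^ k * (n - 1)) - 1) * f (q ^ nq_bracket n k * t ^ (n ^ k))))"
    by (simp add: fun_eq_iff nq_jackson_def term_eq)
  ultimately show ?thesis by simp
qed

end
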